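(* Let $a,b,c$ be nonnegative real numbers. The (unnormalized) state $A[a,b,c]\in M_3\otimes M_3$ is a PPTES (an entangled state with positive partial transpose) if and only if $$1\le a<2,\qquad bc\ge1,\qquad (b+a-2)(c+a-2)<(1-a)^2.$$
   Context: $M_n$ is the algebra of complex $n\times n$ matrices, with matrix units $e_{ij}$. $M_3\otimes M_3$ is identified with $9\times 9$ matrices using the lexicographically ordered basis $e_i\otimes e_j$ of $\mathbb C^3\otimes\mathbb C^3$. For nonnegative reals $a,b,c$, $A[a,b,c]$ is the $9\times9$ matrix with diagonal $(a,c,b,b,a,c,c,b,a)$, with entry $1$ at the positions $(i,j)$ for $i\ne j$ in $\{1,5,9\}$, and all other entries $0$. States are considered without normalization of the trace. A matrix is separable if it is a finite sum of matrices $zz^*$ with $z=x\otimes y$ a product vector in $\mathbb C^3\otimes\mathbb C^3$. For $A=\sum e_{ij}\otimes x_{ij}$ the partial transpose is $A^\Gamma=\sum e_{ij}\otimes x_{ji}$; $A$ is of PPT if both $A$ and $A^\Gamma$ are positive semi-definite. A PPTES is a matrix of PPT which is not separable. *)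

theory Defs
  imports "HOL-Analysis.Analysis"
begin

text \<open>
  The algebra of m-by-m complex matrices is \<^typ>\<open>complex^'m^'m\<close>. The tensor product of the
  algebras on index types \<^typ>\<open>'m\<close> and \<^typ>\<open>'n\<close> has index type \<^typ>\<open>'m \<times> 'n\<close>,
  where the pair \<open>(i, k)\<close> stands for the basis vector e_i \<otimes> e_k.
\<close>

definition mat_unit :: "'m \<Rightarrow> 'm \<Rightarrow> complex^'m^'m" where
  "mat_unit i j = (\<chi> r s. if r = i \<and> s = j then 1 else 0)"

definition mat_tensor ::
    "complex^'m^'m \<Rightarrow> complex^'n^'n \<Rightarrow> complex^('m::finite \<times> 'n::finite)^('m \<times> 'n)" where
  "mat_tensor X Y = (\<chi> p q. X $ fst p $ fst q * Y $ snd p $ snd q)"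

definition vec_tensor :: "complex^'m \<Rightarrow> complex^'n \<Rightarrow> complex^('m::finite \<times> 'n::finite)" where
  "vec_tensor x y = (\<chi> p. x $ fst p * y $ snd p)"

definition conj_transpose :: "complex^'m^'m \<Rightarrow> complex^'m^'m" where
  "conj_transpose A = (\<chi> p q. cnj (A $ q $ p))"

definition pos_semidef :: "complex^'m^'m \<Rightarrow> bool" where
  "pos_semidef A \<longleftrightarrow> conj_transpose A = A \<and>
     (\<forall>v :: complex^'m. 0 \<le> Re (\<Sum>p\<in>UNIV. cnj (v $ p) * (A *v v) $ p))"

text \<open>The matrix z z* of a column vector z.\<close>

definition outer_self :: "complex^'m \<Rightarrow> complex^'m^'m" where
  "outer_self z = (\<chi> p q. z $ p * cnj (z $ q))"

definition separable :: "complex^('m::finite \<times> 'n::finite)^('m \<times> 'n) \<Rightarrow> bool" where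
  "separable A \<longleftrightarrow> (\<exists>(N::nat) (x :: nat \<Rightarrow> complex^'m) (y :: nat \<Rightarrow> complex^'n).
     A = (\<Sum>k<N. outer_self (vec_tensor (x k) (y k))))"

text \<open>The blocks x_ij in the unique expansion of a matrix as the sum of all e_ij \<otimes> x_ij.\<close>

definition block :: "complex^('m::finite \<times> 'n::finite)^('m \<times> 'n) \<Rightarrow> 'm::finite \<Rightarrow> 'm \<Rightarrow> complex^'n^'n" where
  "block A i j = (\<chi> k l. A $ (i, k) $ (j, l))"

definition partial_transpose ::
    "complex^('m::finite \<times> 'n::finite)^('m \<times> 'n) \<Rightarrow> complex^('m::finite \<times> 'n::finite)^('m \<times> 'n)" where
  "partial_transpose A =
     (\<Sum>i\<in>UNIV. \<Sum>j\<in>UNIV. mat_tensor (mat_unit i j) (block A j i))"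

lemma sum_blocks_nth:
  fixes B :: "'m::finite \<Rightarrow> 'm \<Rightarrow> complex^'n^'n"
  shows "(\<Sum>i\<in>UNIV. \<Sum>j\<in>UNIV. mat_tensor (mat_unit i j) (B i j)) $ (i, k) $ (j, l)
    = B i j $ k $ l"
proof -
  have "(\<Sum>i'\<in>UNIV. \<Sum>j'\<in>UNIV. mat_tensor (mat_unit i' j') (B i' j')) $ (i, k) $ (j, l)
      = (\<Sum>i'\<in>UNIV. \<Sum>j'\<in>UNIV. if i' = i then if j' = j then B i' j' $ k $ l else 0 else 0)"
    by (auto simp: mat_tensor_def mat_unit_def intro!: sum.cong)
  also have "\<dots> = (\<Sum>i'\<in>UNIV. if i' = i then B i' j $ k $ l else 0)"
    by (intro sum.cong) auto
  also have "\<dots> = B i j $ k $ l"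
    by simp
  finally show ?thesis .
qed

lemma block_expansion:
  "A = (\<Sum>i\<in>UNIV. \<Sum>j\<in>UNIV. mat_tensor (mat_unit i j) (block A i j))"
  by (simp add: vec_eq_iff sum_blocks_nth del: sum_component) (simp add: block_def)

lemma partial_transpose_nth:
  "partial_transpose A $ (i, k) $ (j, l) = A $ (j, k) $ (i, l)"
  unfolding partial_transpose_def sum_blocks_nth by (simp add: block_def)

definition ppt :: "complex^('m::finite \<times> 'n::finite)^('m \<times> 'n) \<Rightarrow> bool" where
  "ppt A \<longleftrightarrow> pos_semidef A \<and> pos_semidef (partial_transpose A)"

definition pptes :: "complex^('m::finite \<times> 'n::finite)^('m \<times> 'n) \<Rightarrow> bool" where
  "pptes A \<longleftrightarrow> ppt A \<and> \<not> separable A"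

text \<open>
  The position, from 1 to 9, of e_i \<otimes> e_k in the lexicographically ordered basis. The type
  \<^typ>\<open>3\<close> consists of \<open>1\<close>, \<open>2\<close> and \<open>3\<close>, but arithmetic on it is modulo 3 (so \<open>3 = 0\<close>);
  hence the explicit tables.
\<close>

definition lex_pos :: "3 \<times> 3 \<Rightarrow> nat" where
  "lex_pos p = (vector [0, 3, 6] :: nat^3) $ fst p + (vector [1, 2, 3] :: nat^3) $ snd p"

definition A_mat :: "real \<Rightarrow> real \<Rightarrow> real \<Rightarrow> complex^(3 \<times> 3)^(3 \<times> 3)" where
  "A_mat a b c = (\<chi> p q.
     if p = q then complex_of_real ([a, c, b, b, a, c, c, b, a] ! (lex_pos p - 1))
     else if lex_pos p \<in> {1, 5, 9} \<and> lex_pos q \<in> {1, 5, 9} then 1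
     else 0)"

lemma lex_pos_values:
  "map lex_pos [(1,1), (1,2), (1,3), (2,1), (2,2), (2,3), (3,1), (3,2), (3,3)] = [1..<10]"
  by (simp add: lex_pos_def upt_rec)

end

theory Submission
  imports Defs
begin

text \<open>
  Positivity of \<open>A[a,b,c]\<close> amounts to \<open>a \<ge> 1\<close>, that of its partial transpose to \<open>bc \<ge> 1\<close>.
  The separable \<open>A[a,b,c]\<close> are the members of the convex cone spanned by \<open>A[1,1,1]\<close>, by all
  \<open>A[2,r,1/r]\<close> and by the diagonal matrices: with \<open>s = min (a - 1) 1\<close> one has
  \<open>A[a,b,c] = (1 - s) A[1,1,1] + s A[2,r,1/r]\<close> plus a diagonal matrix.
  The generators are averages of product vectors over diagonal unitaries \<open>D \<otimes> cnj D\<close>.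
  The dual cone is spanned by nonnegative diagonal matrices and the generalized Choi maps with diagonal parameters
  proportional to \<open>(1 - t)^2\<close>, \<open>1\<close>, \<open>t^2\<close>. Their block positivity reduces, by the Cauchy-Schwarz
  inequality, to a cyclic cubic inequality. The value of such a witness on \<open>A[a,b,c]\<close> is a multiple
  of the quadratic \<open>(a + c - 2) t^2 - 2 (a - 1) t + (a + b - 2)\<close>, and the strict
  inequality between products makes this quadratic negative for some \<open>t > 0\<close>.
\<close>

section \<open>Coordinates and entries of \<open>A[a,b,c]\<close>\<close>

lemma Re_cnj_mult_ge: "- (cmod z * cmod w) \<le> Re (cnj z * w)"
  using complex_Re_le_cmod[of "- (cnj z * w)"] by (simp add: norm_mult)

lemma sum_UNIV_3_times_3:
  fixes f :: "3 \<times> 3 \<Rightarrow> 'a::comm_monoid_add"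
  shows "(\<Sum>p\<in>UNIV. f p) = f (1,1) + f (1,2) + f (1,3) + f (2,1) + f (2,2) + f (2,3)
    + f (3,1) + f (3,2) + f (3,3)"
proof -
  have "(\<Sum>p\<in>UNIV. f p) = (\<Sum>i\<in>UNIV. \<Sum>k\<in>UNIV. f (i, k))"
    by (simp add: sum.cartesian_product flip: UNIV_Times_UNIV)
  then show ?thesis
    by (simp add: sum_3 add.assoc)
qed

lemma lex_pos_simps:
  "lex_pos (1,1) = 1" "lex_pos (1,2) = 2" "lex_pos (1,3) = 3"
  "lex_pos (2,1) = 4" "lex_pos (2,2) = 5" "lex_pos (2,3) = 6"
  "lex_pos (3,1) = 7" "lex_pos (3,2) = 8" "lex_pos (3,3) = 9"
  by (simp_all add: lex_pos_def)

text \<open>Trades position numbers for pairs: 1, 5, 9 are the pairs (i,i), \<open>c\<close> sits at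
  the cyclic steps (1,2), (2,3), (3,1) and \<open>b\<close> at their reversals.\<close>

lemma A_mat_nth:
  "A_mat a b c $ (i, k) $ (j, l) =
    (if i = j \<and> k = l then
       if i = k then of_real a
       else if (i, k) \<in> {(1,2), (2,3), (3,1)} then of_real c else of_real b
     else if i = k \<and> j = l then 1 else 0)"
  using exhaust_3[of i] exhaust_3[of j] exhaust_3[of k] exhaust_3[of l]
  by (elim disjE) (simp_all add: A_mat_def lex_pos_simps)

subsection \<open>Positive partial transpose\<close>

definition herm_form :: "complex^'m^'m \<Rightarrow> complex^'m \<Rightarrow> complex" where
  "herm_form A v = (\<Sum>p\<in>UNIV. cnj (v $ p) * (A *v v) $ p)"

lemma pos_semidef_iff_herm_form:
  "pos_semidef A \<longleftrightarrow> conj_transpose A = A \<and> (\<forall>v. 0 \<le> Re (herm_form A v))"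
  by (simp add: pos_semidef_def herm_form_def)

text \<open>The block on (1,1), (2,2), (3,3) is \<open>(a - 1) I\<close> plus the all-ones matrix,
  whose form is the squared modulus of the coordinate sum.\<close>

lemma herm_form_A_mat:
  "Re (herm_form (A_mat a b c) v) =
    (a - 1) * ((cmod (v$(1,1)))\<^sup>2 + (cmod (v$(2,2)))\<^sup>2 + (cmod (v$(3,3)))\<^sup>2)
    + (cmod (v$(1,1) + v$(2,2) + v$(3,3)))\<^sup>2
    + c * ((cmod (v$(1,2)))\<^sup>2 + (cmod (v$(2,3)))\<^sup>2 + (cmod (v$(3,1)))\<^sup>2)
    + b * ((cmod (v$(2,1)))\<^sup>2 + (cmod (v$(3,2)))\<^sup>2 + (cmod (v$(1,3)))\<^sup>2)"
  unfolding cmod_power2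
  by (simp add: herm_form_def matrix_vector_mult_def sum_UNIV_3_times_3 A_mat_nth
      power2_eq_square algebra_simps)

text \<open>Partial transposition moves the ones to the positions joining (i,k) and (k,i), which
  leaves three 2 by 2 blocks with diagonal c, b and off-diagonal 1.\<close>

lemma herm_form_partial_transpose_A_mat:
  "Re (herm_form (partial_transpose (A_mat a b c)) v) =
    a * ((cmod (v$(1,1)))\<^sup>2 + (cmod (v$(2,2)))\<^sup>2 + (cmod (v$(3,3)))\<^sup>2)
    + (c * (cmod (v$(1,2)))\<^sup>2 + b * (cmod (v$(2,1)))\<^sup>2 + 2 * Re (cnj (v$(1,2)) * v$(2,1)))
    + (c * (cmod (v$(2,3)))\<^sup>2 + b * (cmod (v$(3,2)))\<^sup>2 + 2 * Re (cnj (v$(2,3)) * v$(3,2)))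
    + (c * (cmod (v$(3,1)))\<^sup>2 + b * (cmod (v$(1,3)))\<^sup>2 + 2 * Re (cnj (v$(3,1)) * v$(1,3)))"
  unfolding cmod_power2
  by (simp add: herm_form_def matrix_vector_mult_def sum_UNIV_3_times_3 partial_transpose_nth
      A_mat_nth power2_eq_square algebra_simps)

lemma conj_transpose_A_mat: "conj_transpose (A_mat a b c) = A_mat a b c"
  by (simp add: vec_eq_iff conj_transpose_def A_mat_nth)

lemma conj_transpose_partial_transpose_A_mat:
  "conj_transpose (partial_transpose (A_mat a b c)) = partial_transpose (A_mat a b c)"
  by (auto simp: vec_eq_iff conj_transpose_def partial_transpose_nth A_mat_nth)

lemma two_by_two_form_nonneg:
  assumes "0 \<le> b" "0 \<le> c" "1 \<le> b * c"
  shows "0 \<le> c * (cmod z)\<^sup>2 + b * (cmod w)\<^sup>2 + 2 * Re (cnj z * w)"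
proof -
  have "1 \<le> sqrt c * sqrt b"
    using assms by (simp add: mult.commute flip: real_sqrt_mult)
  then have "cmod z * cmod w \<le> (sqrt c * sqrt b) * (cmod z * cmod w)"
    by (metis mult_right_mono mult_1 norm_ge_zero mult_nonneg_nonneg)
  moreover have "0 \<le> (sqrt c * cmod z - sqrt b * cmod w)\<^sup>2"
    by simp
  then have "2 * ((sqrt c * sqrt b) * (cmod z * cmod w)) \<le> c * (cmod z)\<^sup>2 + b * (cmod w)\<^sup>2"
    using assms by (simp add: power2_diff power_mult_distrib algebra_simps)
  ultimately show ?thesis
    using Re_cnj_mult_ge[of z w] by linarith
qed

lemma ppt_A_mat_iff:
  assumes "0 \<le> a" "0 \<le> b" "0 \<le> c"
  shows "ppt (A_mat a b c) \<longleftrightarrow> 1 \<le> a \<and> 1 \<le> b * c"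
proof
  assume "ppt (A_mat a b c)"
  then have pos: "0 \<le> Re (herm_form (A_mat a b c) v)"
      "0 \<le> Re (herm_form (partial_transpose (A_mat a b c)) v)" for v
    by (auto simp: ppt_def pos_semidef_iff_herm_form)
  \<comment> \<open>The test vector has coordinate sum 0 on the pairs (i,i), which removes the
    all-ones part.\<close>
  have "1 \<le> a"
    using pos(1)[of "\<chi> p. if p = (1,1) then 1 else if p = (2,2) then -1 else 0"]
    by (simp add: herm_form_A_mat)
  moreover have form: "0 \<le> c * x\<^sup>2 + b * y\<^sup>2 - 2 * x * y" for x y
    using pos(2)[of "\<chi> p. if p = (1,2) then of_real x else if p = (2,1) then - of_real y else 0"]
    by (simp add: herm_form_partial_transpose_A_mat)
  \<comment> \<open>At y = c the form is least at x = 1, with value c (b c - 1). If c = 0, the point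
    (b + 1, 1) gives the negative value - b - 2.\<close>
  have "1 \<le> b * c"
  proof (cases "c = 0")
    case True
    then show ?thesis
      using form[of "b + 1" 1] assms by simp
  next
    case False
    then show ?thesis
      using form[of 1 c] assms by (simp add: power2_eq_square algebra_simps)
  qed
  ultimately show "1 \<le> a \<and> 1 \<le> b * c"
    by simp
next
  assume "1 \<le> a \<and> 1 \<le> b * c"
  then have a: "1 \<le> a" and bc: "1 \<le> b * c"
    by simp_all
  have "0 \<le> Re (herm_form (A_mat a b c) v)" for v
    unfolding herm_form_A_mat using a assms by (intro add_nonneg_nonneg mult_nonneg_nonneg) auto
  moreover have "0 \<le> Re (herm_form (partial_transpose (A_mat a b c)) v)" for v
    unfolding herm_form_partial_transpose_A_mat using assms(1)
    by (intro add_nonneg_nonneg[OF add_nonneg_nonneg[OF add_nonneg_nonneg]]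
        two_by_two_form_nonneg[OF assms(2,3) bc]) simp
  ultimately show "ppt (A_mat a b c)"
    by (simp add: ppt_def pos_semidef_iff_herm_form conj_transpose_A_mat
        conj_transpose_partial_transpose_A_mat)
qed

subsection \<open>Separable matrices\<close>

lemma separable_0: "separable 0"
  unfolding separable_def by (rule exI[of _ 0]) simp

lemma separable_outer_self: "separable (outer_self (vec_tensor x y))"
  unfolding separable_def by (rule exI[of _ 1]) auto

lemma separable_add:
  fixes A B :: "complex^('m::finite \<times> 'n::finite)^('m \<times> 'n)"
  assumes "separable A" "separable B"
  shows "separable (A + B)"
proof -
  obtain N :: nat and x :: "nat \<Rightarrow> complex^'m" and y :: "nat \<Rightarrow> complex^'n" where A: "A = (\<Sum>k<N. outer_self (vec_tensor (x k) (y k)))"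
    using assms(1) unfolding separable_def by blast
  obtain M :: nat and x' :: "nat \<Rightarrow> complex^'m" and y' :: "nat \<Rightarrow> complex^'n" where B: "B = (\<Sum>k<M. outer_self (vec_tensor (x' k) (y' k)))"
    using assms(2) unfolding separable_def by blast
  let ?x = "\<lambda>k. if k < N then x k else x' (k - N)"
  let ?y = "\<lambda>k. if k < N then y k else y' (k - N)"
  have "(\<Sum>k<N + m. outer_self (vec_tensor (?x k) (?y k)))
    = A + (\<Sum>k<m. outer_self (vec_tensor (x' k) (y' k)))" for m
    by (induction m) (simp_all add: A add.assoc)
  then have "A + B = (\<Sum>k<N + M. outer_self (vec_tensor (?x k) (?y k)))"
    by (simp only: B)
  then show ?thesis
    unfolding separable_def
    by (intro exI[where x = "N + M"] exI[where x = ?x] exI[where x = ?y])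
qed

lemma separable_sum:
  assumes "\<And>i. i \<in> I \<Longrightarrow> separable (f i)"
  shows "separable (\<Sum>i\<in>I. f i)"
  using assms by (induction I rule: infinite_finite_induct) (auto intro: separable_0 separable_add)

lemma separable_diagonal:
  fixes d :: "'m::finite \<times> 'n::finite \<Rightarrow> real"
  assumes "\<And>p. 0 \<le> d p"
  shows "separable (\<chi> p q. if p = q then of_real (d p) else 0)"
proof -
  let ?z = "\<lambda>p. vec_tensor (axis (fst p) (of_real (sqrt (d p)))) (axis (snd p) 1)"
  have "(\<Sum>p\<in>UNIV. outer_self (?z p)) $ q $ r = (if q = r then of_real (d q) else 0)" for q r
  proof -
    have "outer_self (?z p) $ q $ r = (if p = q then if q = r then of_real (d q) else 0 else 0)" for p
      using assms by (cases p; cases q; cases r)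
        (auto simp: outer_self_def vec_tensor_def axis_def simp flip: of_real_mult)
    then show ?thesis
      by simp
  qed
  then have "(\<chi> p q. if p = q then of_real (d p) else 0) = (\<Sum>p\<in>UNIV. outer_self (?z p))"
    by (simp add: vec_eq_iff)
  then show ?thesis
    using separable_sum[of UNIV "\<lambda>p. outer_self (?z p)"] separable_outer_self by metis
qed

text \<open>The average of the product vector \<open>x \<otimes> y\<close> over all \<open>D \<otimes> cnj D\<close>, D diagonal unitary.
  Diagonal entries in the cube roots of unity already give the full average.\<close>

definition twirl :: "real^3 \<Rightarrow> real^3 \<Rightarrow> complex^(3 \<times> 3)^(3 \<times> 3)" where
  "twirl x y = (\<chi> p q. if p = q \<or> fst p = snd p \<and> fst q = snd q
     then of_real (x $ fst p * y $ snd p * (x $ fst q * y $ snd q)) else 0)"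

lemma separable_twirl: "separable (twirl x y)"
proof -
  define w where "w = Complex (- 1 / 2) (sqrt 3 / 2)"
  have cnj_w: "cnj w = w\<^sup>2" and w2: "w\<^sup>2 = - 1 - w"
    by (simp_all add: w_def power2_eq_square complex_eq_iff)
  have w3: "w * w\<^sup>2 = 1"
    by (simp add: w_def power2_eq_square complex_eq_iff)
  have pow: "w ^ m = w ^ (m mod 3)" for m
  proof -
    have "w ^ m = (w ^ 3) ^ (m div 3) * w ^ (m mod 3)"
      by (simp flip: power_mult power_add)
    then show ?thesis
      using w3 by (simp add: power3_eq_cube power2_eq_square mult.assoc)
  qed
  have root_sum: "(\<Sum>u<3. w ^ (u * m)) = (if m mod 3 = 0 then 3 else 0)" for m
  proof -
    have "w ^ (u * m) = (w ^ (m mod 3)) ^ u" for u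
      by (simp only: mult.commute[of u] power_mult flip: pow[of m])
    then have expand: "(\<Sum>u<3. w ^ (u * m)) = 1 + w ^ (m mod 3) + (w ^ (m mod 3))\<^sup>2"
      by (simp add: lessThan_nat_numeral add_ac)
    have roots: "1 + w + w\<^sup>2 = 0" "1 + w\<^sup>2 + w ^ 4 = 0"
      using w2 by algebra+
    have "m mod 3 < 3"
      by simp
    then consider "m mod 3 = 0" | "m mod 3 = 1" | "m mod 3 = 2"
      by linarith
    then show ?thesis
      unfolding expand by cases (simp_all add: roots)
  qed
  \<comment> \<open>Exponents of the diagonal of D; its first entry can be 1, since a scalar phase
    cancels in D \<otimes> cnj D.\<close>
  define e :: "nat \<times> nat \<Rightarrow> 3 \<Rightarrow> nat" where
    "e n i = (if i = 2 then fst n else if i = 3 then snd n else 0)" for n i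
  define N :: "(nat \<times> nat) set" where "N = {..<3} \<times> {..<3}"
  have sum: "(\<Sum>n\<in>N. w ^ e n i * cnj (w ^ e n k) * cnj (w ^ e n j * cnj (w ^ e n l)))
    = (if (i, k) = (j, l) \<or> i = k \<and> j = l then 9 else 0)" for i j k l
  proof -
    have cnj_pow: "cnj (w ^ m) = w ^ (2 * m)" for m
      by (simp add: cnj_w power_mult)
    \<comment> \<open>Conjugation doubles exponents, so modulo 3 \<open>m r\<close> is [i=r] - [k=r]
      - [j=r] + [l=r]. This lies between -2 and 2, so it vanishes modulo 3 only if it is 0; the
      surviving terms have {i,l} = {k,j} as multisets.\<close>
    define m :: "3 \<Rightarrow> nat" where
      "m r = of_bool (i = r) + 2 * of_bool (k = r) + 2 * of_bool (j = r) + 4 * of_bool (l = r)" for r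
    have exponent: "e n i + 2 * e n k + 2 * e n j + 2 * (2 * e n l) = fst n * m 2 + snd n * m 3" for n
      by (simp add: e_def m_def algebra_simps)
    have "w ^ e n i * cnj (w ^ e n k) * cnj (w ^ e n j * cnj (w ^ e n l))
      = w ^ (fst n * m 2) * w ^ (snd n * m 3)" for n
      unfolding power_add[symmetric] exponent[symmetric]
      by (simp only: complex_cnj_mult complex_cnj_cnj cnj_pow power_add mult_ac)
    then have "(\<Sum>n\<in>N. w ^ e n i * cnj (w ^ e n k) * cnj (w ^ e n j * cnj (w ^ e n l)))
      = (\<Sum>u<3. w ^ (u * m 2)) * (\<Sum>v<3. w ^ (v * m 3))"
      by (simp add: N_def sum_product sum.cartesian_product case_prod_beta)
    then show ?thesis
      unfolding root_sum
      using exhaust_3[of i] exhaust_3[of j] exhaust_3[of k] exhaust_3[of l]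
      by (elim disjE) (simp_all add: m_def)
  qed
  \<comment> \<open>The factor 1/3 turns the sum over nine choices of D into an average.\<close>
  let ?z = "\<lambda>n. vec_tensor (\<chi> i. of_real (x $ i) * w ^ e n i / 3) (\<chi> k. of_real (y $ k) * cnj (w ^ e n k))"
  have "(\<Sum>n\<in>N. outer_self (?z n)) $ (i, k) $ (j, l) = twirl x y $ (i, k) $ (j, l)" for i j k l
  proof -
    have "(\<Sum>n\<in>N. outer_self (?z n)) $ (i, k) $ (j, l) = of_real (x $ i * y $ k * (x $ j * y $ l)) / 9 *
      (\<Sum>n\<in>N. w ^ e n i * cnj (w ^ e n k) * cnj (w ^ e n j * cnj (w ^ e n l)))"
      unfolding sum_distrib_left sum_component
      by (intro sum.cong) (simp_all add: outer_self_def vec_tensor_def mult_ac)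
    also have "\<dots> = twirl x y $ (i, k) $ (j, l)"
      unfolding sum by (simp add: twirl_def)
    finally show ?thesis .
  qed
  then have "twirl x y = (\<Sum>n\<in>N. outer_self (?z n))"
    by (simp add: vec_eq_iff)
  then show ?thesis
    by (simp only: separable_sum separable_outer_self)
qed

lemma separable_A_mat:
  assumes "0 \<le> s" "s \<le> 1" "1 + s \<le> a" "1 - s \<le> b" "1 - s \<le> c"
    and prod: "s\<^sup>2 \<le> (b - (1 - s)) * (c - (1 - s))"
  shows "separable (A_mat a b c)"
proof -
  define C where "C = c - (1 - s)"
  \<comment> \<open>\<open>C\<close> is what remains of \<open>c\<close> after (1 - s) A[1,1,1] is
    removed. If C = 0, then \<open>prod\<close> forces s = 0, and the convention s / 0 = 0 keeps the
    formulas valid.\<close>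
  define p q r h where "p = sqrt C" and "q = sqrt s" and "r = sqrt (s / C)" and "h = sqrt (1 - s)"
  have C: "0 \<le> C" "C = 0 \<Longrightarrow> s = 0"
    using assms by (auto simp: C_def)
  have pr: "p * r = q"
    using C by (cases "C = 0") (auto simp: p_def q_def r_def simp flip: real_sqrt_mult)
  have sq: "p * p = C" "q * q = s" "h * h = 1 - s" "r * r = s / C"
    using assms C by (auto simp: p_def q_def r_def h_def)
  have B: "s * s / C \<le> b - (1 - s)"
    using assms(4) prod C by (cases "C = 0")
      (auto simp: C_def[symmetric] power2_eq_square divide_le_eq)
  define d :: "3 \<times> 3 \<Rightarrow> real" where
    "d = (\<lambda>(i, k). if i = k then a - (1 + s)
       else if (i, k) \<in> {(1,2), (2,3), (3,1)} then 0 else b - (1 - s) - s * s / C)"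
  \<comment> \<open>The first term is (1 - s) A[1,1,1]. The next three, one per pair of coordinates,
    sum to s A[2, s/C, C/s] when s > 0; p r = q makes their off-diagonal entries equal to s.\<close>
  have "A_mat a b c = twirl (vector [h, h, h]) (vector [1, 1, 1])
      + twirl (vector [p, q, 0]) (vector [r, 1, 0])
      + twirl (vector [0, p, q]) (vector [0, r, 1])
      + twirl (vector [q, 0, p]) (vector [1, 0, r])
      + (\<chi> p q. if p = q then of_real (d p) else 0)"
  proof -
    have qr: "q * r * (q * r) = s * s / C"
      using sq by (metis mult.assoc mult.left_commute times_divide_eq_right)
    have "A_mat a b c $ (i, k) $ (j, l) = (twirl (vector [h, h, h]) (vector [1, 1, 1])
      + twirl (vector [p, q, 0]) (vector [r, 1, 0])
      + twirl (vector [0, p, q]) (vector [0, r, 1])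
      + twirl (vector [q, 0, p]) (vector [1, 0, r])
      + (\<chi> p q. if p = q then of_real (d p) else 0)) $ (i, k) $ (j, l)" for i j k l
      using exhaust_3[of i] exhaust_3[of j] exhaust_3[of k] exhaust_3[of l]
      by (elim disjE, simp_all add: A_mat_nth twirl_def d_def complex_eq_iff,
          simp_all add: pr qr sq) (simp_all add: C_def)
    then show ?thesis
      by (simp add: vec_eq_iff)
  qed
  moreover have "0 \<le> d u" for u
    using assms B by (auto simp: d_def split: prod.split)
  ultimately show ?thesis
    by (simp only: separable_add separable_twirl separable_diagonal)
qed

subsection \<open>The witnesses\<close>

text \<open>The cubic vanishes at \<open>(1, 1, 1)\<close> and, on each face, along one ray. Shifting by the least
  variable leaves only manifestly nonnegative terms.\<close>

lemma witness_cubic_ordered: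
  fixes t u v w :: real
  assumes "0 \<le> w" "w \<le> u" "w \<le> v"
  defines "D1 \<equiv> (2 - 3*t + 2*t\<^sup>2) * u + v + t\<^sup>2 * w"
    and "D2 \<equiv> (2 - 3*t + 2*t\<^sup>2) * v + w + t\<^sup>2 * u"
    and "D3 \<equiv> (2 - 3*t + 2*t\<^sup>2) * w + u + t\<^sup>2 * v"
  shows "(1 - t + t\<^sup>2) * (u * D2 * D3 + v * D1 * D3 + w * D1 * D2) \<le> D1 * D2 * D3"
proof -
  define p q where "p = u - w" and "q = v - w"
  have uv: "u = w + p" "v = w + q"
    by (simp_all add: p_def q_def)
  have "D1 * D2 * D3 - (1 - t + t\<^sup>2) * (u * D2 * D3 + v * D1 * D3 + w * D1 * D2)
    = (1 - t)\<^sup>2 * (w * (1 - t + t\<^sup>2)\<^sup>2 * (p\<^sup>2 - p * q + q\<^sup>2) + (p + t\<^sup>2 * q) * (t * p - q)\<^sup>2)"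
    unfolding D1_def D2_def D3_def uv by algebra
  moreover have "0 \<le> p\<^sup>2 - p * q + q\<^sup>2"
    using sum_squares_ge_zero[of "p - q / 2" q] zero_le_power2[of q] zero_le_power2[of "p - q / 2"]
    by (simp add: power2_eq_square algebra_simps)
  moreover have "0 \<le> p" "0 \<le> q"
    using assms by (simp_all add: p_def q_def)
  ultimately show ?thesis
    using assms(1) by (smt (verit) mult_nonneg_nonneg zero_le_power2)
qed

text \<open>Rotating (u, v, w) rotates D1, D2, D3, so the least variable may be taken to be the
  last.\<close>

lemma witness_cubic:
  fixes t u v w :: real
  assumes "0 \<le> u" "0 \<le> v" "0 \<le> w"
  defines "D1 \<equiv> (2 - 3*t + 2*t\<^sup>2) * u + v + t\<^sup>2 * w"
    and "D2 \<equiv> (2 - 3*t + 2*t\<^sup>2) * v + w + t\<^sup>2 * u"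
    and "D3 \<equiv> (2 - 3*t + 2*t\<^sup>2) * w + u + t\<^sup>2 * v"
  shows "(1 - t + t\<^sup>2) * (u * D2 * D3 + v * D1 * D3 + w * D1 * D2) \<le> D1 * D2 * D3"
proof -
  consider "w \<le> u" "w \<le> v" | "u \<le> v" "u \<le> w" | "v \<le> w" "v \<le> u"
    by linarith
  then show ?thesis
  proof cases
    case 1
    then show ?thesis
      using witness_cubic_ordered[of w u v t] assms(3) by (simp add: D1_def D2_def D3_def)
  next
    case 2
    then show ?thesis
      using witness_cubic_ordered[of u v w t] assms(1) unfolding D1_def D2_def D3_def
      by (simp add: ac_simps)
  next
    case 3
    then show ?thesis
      using witness_cubic_ordered[of v w u t] assms(2) unfolding D1_def D2_def D3_def
      by (simp add: ac_simps)
  qed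
qed

text \<open>By weighted Cauchy-Schwarz the squared sum is at most (sum of x_i^2 / D_i) times the
  right-hand side, and the cubic bounds the first factor by 1 / (1 - t + t^2). Below, N / P is that
  factor with denominators cleared.\<close>

lemma witness_biquadratic:
  fixes t x1 x2 x3 y1 y2 y3 :: real
  assumes "0 < t"
  defines "D1 \<equiv> (2 - 3*t + 2*t\<^sup>2) * x1\<^sup>2 + x2\<^sup>2 + t\<^sup>2 * x3\<^sup>2"
    and "D2 \<equiv> (2 - 3*t + 2*t\<^sup>2) * x2\<^sup>2 + x3\<^sup>2 + t\<^sup>2 * x1\<^sup>2"
    and "D3 \<equiv> (2 - 3*t + 2*t\<^sup>2) * x3\<^sup>2 + x1\<^sup>2 + t\<^sup>2 * x2\<^sup>2"
  shows "(1 - t + t\<^sup>2) * (x1 * y1 + x2 * y2 + x3 * y3)\<^sup>2 \<le> D1 * y1\<^sup>2 + D2 * y2\<^sup>2 + D3 * y3\<^sup>2"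
proof (cases "x1 = 0 \<and> x2 = 0 \<and> x3 = 0")
  case True
  then show ?thesis
    by (simp add: D1_def D2_def D3_def)
next
  case False
  have coeff: "0 < 2 - 3*t + 2*t\<^sup>2"
    using zero_le_power2[of "t - 3/4"] by (simp add: power2_eq_square algebra_simps)
  have k: "0 \<le> 1 - t + t\<^sup>2"
    using zero_le_power2[of "t - 1/2"] by (simp add: power2_eq_square algebra_simps)
  have "0 < f * x\<^sup>2 + y\<^sup>2 + t\<^sup>2 * z\<^sup>2" if "0 < f" "x \<noteq> 0 \<or> y \<noteq> 0 \<or> z \<noteq> 0" for f x y z
    using that assms(1) by (cases "x = 0"; cases "y = 0"; cases "z = 0") (auto intro!: add_pos_pos)
  then have pos: "0 < D1" "0 < D2" "0 < D3"
    using False coeff unfolding D1_def D2_def D3_def by blast+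
  define P N where "P = D1 * D2 * D3" and "N = x1\<^sup>2 * D2 * D3 + x2\<^sup>2 * D1 * D3 + x3\<^sup>2 * D1 * D2"
  define S where "S = D1 * y1\<^sup>2 + D2 * y2\<^sup>2 + D3 * y3\<^sup>2"
  \<comment> \<open>Lagrange's identity for Cauchy-Schwarz with the weights D1, D2, D3\<close>
  have "N * S - P * (x1 * y1 + x2 * y2 + x3 * y3)\<^sup>2
    = D3 * (x1 * D2 * y2 - x2 * D1 * y1)\<^sup>2 + D2 * (x1 * D3 * y3 - x3 * D1 * y1)\<^sup>2
      + D1 * (x2 * D3 * y3 - x3 * D2 * y2)\<^sup>2"
    unfolding N_def P_def S_def by algebra
  also have "\<dots> \<ge> 0"
    using pos by simp
  finally have "P * (x1 * y1 + x2 * y2 + x3 * y3)\<^sup>2 \<le> N * S"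
    by simp
  then have "(1 - t + t\<^sup>2) * (P * (x1 * y1 + x2 * y2 + x3 * y3)\<^sup>2) \<le> (1 - t + t\<^sup>2) * N * S"
    using k by (simp add: mult.assoc mult_left_mono)
  also have "\<dots> \<le> P * S"
    using witness_cubic[of "x1\<^sup>2" "x2\<^sup>2" "x3\<^sup>2" t] pos
    unfolding P_def N_def S_def D1_def D2_def D3_def
    by (intro mult_right_mono) auto
  finally have "P * ((1 - t + t\<^sup>2) * (x1 * y1 + x2 * y2 + x3 * y3)\<^sup>2) \<le> P * S"
    by (simp add: mult_ac)
  then show ?thesis
    using pos unfolding S_def P_def by (simp add: mult_le_cancel_left_pos)
qed

text \<open>The pairing with the Choi matrix of a generalized Choi map, scaled by \<open>1 - t + t^2\<close>. The first
  coefficient is \<open>(1 - t)^2 + (1 - t + t^2)\<close>, as the last sum includes the terms \<open>i = j\<close>.\<close>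

definition witness :: "real \<Rightarrow> complex^(3 \<times> 3)^(3 \<times> 3) \<Rightarrow> real" where
  "witness t A = Re (
     of_real (2 - 3*t + 2*t\<^sup>2) * (\<Sum>p\<in>{(1,1), (2,2), (3,3)}. A $ p $ p)
     + (\<Sum>p\<in>{(2,1), (3,2), (1,3)}. A $ p $ p)
     + of_real (t\<^sup>2) * (\<Sum>p\<in>{(1,2), (2,3), (3,1)}. A $ p $ p)
     - of_real (1 - t + t\<^sup>2) * (\<Sum>i\<in>UNIV. \<Sum>j\<in>UNIV. A $ (i,i) $ (j,j)))"

lemma witness_sum: "witness t (\<Sum>k\<in>I. f k) = (\<Sum>k\<in>I. witness t (f k))"
  by (induction I rule: infinite_finite_induct)
    (simp_all add: witness_def sum_3 algebra_simps)

text \<open>The double sum becomes the squared modulus of the sum of x_i y_i; the triangle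
  inequality then reduces the claim to the real case for the moduli.\<close>

lemma witness_product_nonneg:
  assumes "0 < t"
  shows "0 \<le> witness t (outer_self (vec_tensor x y))"
proof -
  define X Y where "X i = cmod (x $ i)" and "Y i = cmod (y $ i)" for i
  define z where "z = x$1 * y$1 + x$2 * y$2 + x$3 * y$3"
  have diag: "outer_self (vec_tensor x y) $ (i,k) $ (i,k) = of_real ((X i)\<^sup>2 * (Y k)\<^sup>2)" for i k
    by (simp add: outer_self_def vec_tensor_def X_def Y_def complex_norm_square mult_ac
        flip: of_real_power)
  have sum: "(\<Sum>i\<in>UNIV. \<Sum>j\<in>UNIV. outer_self (vec_tensor x y) $ (i,i) $ (j,j)) = of_real ((cmod z)\<^sup>2)"
    unfolding complex_norm_square z_def
    by (simp add: outer_self_def vec_tensor_def sum_3 algebra_simps)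
  have W: "witness t (outer_self (vec_tensor x y)) =
      ((2 - 3*t + 2*t\<^sup>2) * (X 1)\<^sup>2 + (X 2)\<^sup>2 + t\<^sup>2 * (X 3)\<^sup>2) * (Y 1)\<^sup>2
      + ((2 - 3*t + 2*t\<^sup>2) * (X 2)\<^sup>2 + (X 3)\<^sup>2 + t\<^sup>2 * (X 1)\<^sup>2) * (Y 2)\<^sup>2
      + ((2 - 3*t + 2*t\<^sup>2) * (X 3)\<^sup>2 + (X 1)\<^sup>2 + t\<^sup>2 * (X 2)\<^sup>2) * (Y 3)\<^sup>2
      - (1 - t + t\<^sup>2) * (cmod z)\<^sup>2"
    by (simp only: witness_def sum) (simp add: diag algebra_simps flip: of_real_power of_real_mult)
  have "cmod z \<le> X 1 * Y 1 + X 2 * Y 2 + X 3 * Y 3"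
    unfolding z_def X_def Y_def
    by (metis (no_types, lifting) norm_triangle_le norm_mult add_right_mono norm_triangle_ineq order_trans)
  moreover have "0 \<le> 1 - t + t\<^sup>2"
    using zero_le_power2[of "t - 1/2"] by (simp add: power2_eq_square algebra_simps)
  ultimately have "(1 - t + t\<^sup>2) * (cmod z)\<^sup>2 \<le> (1 - t + t\<^sup>2) * (X 1 * Y 1 + X 2 * Y 2 + X 3 * Y 3)\<^sup>2"
    by (intro mult_left_mono power_mono) auto
  then show ?thesis
    unfolding W using witness_biquadratic[OF assms, of "X 1" "Y 1" "X 2" "Y 2" "X 3" "Y 3"]
    by linarith
qed

lemma witness_separable_nonneg:
  assumes "0 < t" "separable A"
  shows "0 \<le> witness t A"
  using assms(2) unfolding separable_def
  by (auto simp: witness_sum intro!: sum_nonneg witness_product_nonneg assms(1))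

lemma witness_A_mat:
  "witness t (A_mat a b c) = 3 * ((a + c - 2) * t\<^sup>2 - 2 * (a - 1) * t + (a + b - 2))"
  by (simp add: witness_def A_mat_nth sum_3 algebra_simps flip: of_real_power)

section \<open>Choice of the witness and the equivalence\<close>

lemma quadratic_negative_at_positive:
  fixes P Q R :: real
  assumes "0 \<le> Q" "P * R < Q\<^sup>2"
  shows "\<exists>t>0. P * t\<^sup>2 - 2 * Q * t + R < 0"
proof -
  consider "0 < P" "0 < Q" | "0 < P" "Q = 0" | "P = 0" | "P < 0"
    using assms(1) by linarith
  then show ?thesis
  proof cases
    case 1
    \<comment> \<open>Q / P is the vertex of the parabola.\<close>
    then have "P * (Q / P)\<^sup>2 - 2 * Q * (Q / P) + R = (P * R - Q\<^sup>2) / P"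
      by (simp add: field_simps power2_eq_square)
    then show ?thesis
      using 1 assms(2) by (intro exI[of _ "Q / P"]) (simp add: divide_neg_pos)
  next
    case 2
    then have "R < 0"
      using assms(2) by (simp add: mult_less_0_iff)
    then show ?thesis
      using 2 by (intro exI[of _ "sqrt (- R / (2 * P))"]) (simp add: field_simps)
  next
    case 3
    then have "0 < Q"
      using assms by (cases "Q = 0") auto
    then have "2 * Q * ((\<bar>R\<bar> + 1) / (2 * Q)) = \<bar>R\<bar> + 1"
      by simp
    then show ?thesis
      using 3 \<open>0 < Q\<close> by (intro exI[of _ "(\<bar>R\<bar> + 1) / (2 * Q)"]) auto
  next
    case 4
    \<comment> \<open>Since t \<ge> 1 and P < 0, P t^2 \<le> P t = P - |R|, which outweighs
      R.\<close>
    define t where "t = 1 + \<bar>R\<bar> / (- P)"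
    have t: "1 \<le> t" "P * t = P - \<bar>R\<bar>"
      using 4 by (auto simp: t_def field_simps)
    have "P * t * t \<le> P * t * 1"
      using 4 t by (intro mult_left_mono_neg) auto
    then have "P * t\<^sup>2 \<le> P * t"
      by (simp only: power2_eq_square mult.assoc mult_1_right)
    moreover have "0 \<le> 2 * Q * t"
      using assms t by simp
    ultimately have "P * t\<^sup>2 - 2 * Q * t + R < 0"
      using t 4 by linarith
    then show ?thesis
      using t by (intro exI[of _ t]) auto
  qed
qed

theorem corollary3p2:
  fixes a b c :: real
  assumes "0 \<le> a" and "0 \<le> b" and "0 \<le> c"
  shows "pptes (A_mat a b c) \<longleftrightarrow>
    1 \<le> a \<and> a < 2 \<and> b * c \<ge> 1 \<and> (b + a - 2) * (c + a - 2) < (1 - a)^2"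
proof
  assume "pptes (A_mat a b c)"
  then have ppt: "1 \<le> a" "1 \<le> b * c" and nsep: "\<not> separable (A_mat a b c)"
    using ppt_A_mat_iff[OF assms] by (auto simp: pptes_def)
  \<comment> \<open>For a \<ge> 2 the choice s = 1 reduces the separability condition to b c \<ge>
    1.\<close>
  have "a < 2"
    using separable_A_mat[of 1 a b c] nsep assms ppt by (cases "a < 2") auto
  moreover have "(b + a - 2) * (c + a - 2) < (1 - a)^2"
  proof (rule ccontr)
    assume "\<not> ?thesis"
    then have prod: "(a - 1)\<^sup>2 \<le> (b - (1 - (a - 1))) * (c - (1 - (a - 1)))"
      by (simp add: power2_commute algebra_simps)
    \<comment> \<open>The product bound gives the two factors compatible signs only. Otherwise b and
      c are both at most 2 - a \<le> 1, one of them strictly below 2 - a, so b c < 1.\<close>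
    have "2 - a \<le> b \<and> 2 - a \<le> c"
    proof (rule ccontr)
      assume "\<not> ?thesis"
      have "0 \<le> (b - (2 - a)) * (c - (2 - a))"
        using order_trans[OF zero_le_power2 prod] by (simp add: algebra_simps)
      with \<open>\<not> ?thesis\<close> have "b \<le> 2 - a" "c \<le> 2 - a" "b < 2 - a \<or> c < 2 - a"
        by (auto simp: zero_le_mult_iff)
      moreover from this have "b * c \<le> b" "b * c \<le> c"
        using ppt assms by (auto intro: mult_right_le_one_le mult_left_le_one_le)
      ultimately show False
        using ppt by linarith
    qed
    then show False
      using separable_A_mat[of "a - 1" a b c] nsep ppt \<open>a < 2\<close> prod by auto
  qed
  ultimately show "1 \<le> a \<and> a < 2 \<and> b * c \<ge> 1 \<and> (b + a - 2) * (c + a - 2) < (1 - a)^2"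
    using ppt by simp
next
  assume R: "1 \<le> a \<and> a < 2 \<and> b * c \<ge> 1 \<and> (b + a - 2) * (c + a - 2) < (1 - a)^2"
  then have "0 \<le> a - 1" "(a + c - 2) * (a + b - 2) < (a - 1)\<^sup>2"
    by (auto simp: power2_commute algebra_simps)
  then obtain t where "0 < t" "(a + c - 2) * t\<^sup>2 - 2 * (a - 1) * t + (a + b - 2) < 0"
    using quadratic_negative_at_positive by blast
  then have "\<not> separable (A_mat a b c)"
    using witness_separable_nonneg[of t "A_mat a b c"] by (auto simp: witness_A_mat)
  then show "pptes (A_mat a b c)"
    using R ppt_A_mat_iff[OF assms] by (simp add: pptes_def)
qed

end
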